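(* Let $r\ge 2$ be an integer. Then for every integer $n\ge 3r-5$, $$ \sum_{l=0}^{2r-3}(-1)^l\binom{2r-3}{l}\sum_{\substack{j_1+\cdots+j_r=n-2l\\ j_1,\dots,j_r\ge 1}}B_{j_1}\cdots B_{j_r} =\sum_{k=1}^{r-1}(-1)^{k-1}\frac{n-2k-r+3}{r-1}\binom{n-2k+1}{r-k-1}\binom{n-k-2r+3}{k-1}B_{n-2k-r+3}\,. $$
   Context: The balancing numbers $B_n$ are defined by $B_0=0$, $B_1=1$ and $B_n=6B_{n-1}-B_{n-2}$ for $n\ge 2$. The inner sum is over ordered $r$-tuples of positive integers with the indicated sum (empty, hence $0$, if there is none). Binomial coefficients $\binom{\gamma'}{\gamma}$ with $\gamma'<\gamma$ (nonnegative integers) are $0$. *)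

theory Defs
  imports Complex_Main
begin

fun balancing :: "nat \<Rightarrow> int" where
  "balancing 0 = 0"
| "balancing (Suc 0) = 1"
| "balancing (Suc (Suc n)) = 6 * balancing (Suc n) - balancing n"

(* The target sum m is an integer, so that the set is empty when m is negative. *)
definition positive_tuples :: "nat \<Rightarrow> int \<Rightarrow> nat list set" where
  "positive_tuples r m =
     {js. length js = r \<and> (\<forall>j\<in>set js. j \<ge> 1) \<and> int (sum_list js) = m}"

(* Needed for sums over this set to be meaningful. *)
lemma finite_positive_tuples: "finite (positive_tuples r m)"
proof (rule finite_subset)
  show "positive_tuples r m \<subseteq> {js. set js \<subseteq> {..nat m} \<and> length js = r}"
    unfolding positive_tuples_def using member_le_sum_list by fastforce
  show "finite {js. set js \<subseteq> {..nat m} \<and> length js = r}"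
    by (rule finite_lists_length_eq) simp
qed

end

theory Submission
  imports Defs "HOL-Computational_Algebra.Formal_Power_Series"
begin

text \<open>Let \<open>F\<close> be the generating function of the balancing numbers. Since \<open>F (1 - 6X + X\<^sup>2) = X\<close>,
  it satisfies the Riccati-type equation \<open>(1 - X\<^sup>2) F\<^sup>2 = X\<^sup>2 F'\<close>. The left-hand side of the theorem is the
  coefficient of \<open>X\<^sup>n\<close> in \<open>G\<^sub>r = (1 - X\<^sup>2)\<^bsup>2r-3\<^esup> F\<^sup>r\<close>, and differentiating \<open>F\<^sup>r\<close> gives
  \<open>r G\<^sub>r\<^sub>+\<^sub>1 = X\<^sup>2 ((1 - X\<^sup>2) G\<^sub>r' + 2 (2r - 3) X G\<^sub>r)\<close>. Induction on \<open>r\<close> then reduces the theorem to a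
  termwise identity between products of two binomial coefficients.\<close>

unbundle fps_syntax

section \<open>Generating function of the balancing numbers\<close>

definition balancing_fps :: "real fps" where
  "balancing_fps = Abs_fps (\<lambda>n. real_of_int (balancing n))"

lemma balancing_fps_nth [simp]: "balancing_fps $ n = real_of_int (balancing n)"
  by (simp add: balancing_fps_def)

lemma balancing_fps_mult_denominator:
  "balancing_fps * (1 - 6 * fps_X + fps_X ^ 2) = fps_X"
proof (rule fps_ext)
  fix n
  have "balancing_fps * (1 - 6 * fps_X + fps_X ^ 2) =
      balancing_fps - fps_const 6 * (fps_X * balancing_fps) + fps_X * (fps_X * balancing_fps)"
    by (simp add: algebra_simps power2_eq_square numeral_fps_const)
  then have *: "(balancing_fps * (1 - 6 * fps_X + fps_X ^ 2)) $ n =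
      (balancing_fps - fps_const 6 * (fps_X * balancing_fps) + fps_X * (fps_X * balancing_fps)) $ n"
    by simp
  show "(balancing_fps * (1 - 6 * fps_X + fps_X ^ 2)) $ n = fps_X $ n"
    unfolding * by (cases n rule: balancing.cases) simp_all
qed

text \<open>Differentiating \<open>F * D = X\<close> and multiplying by \<open>D\<close> gives
  \<open>F' * D^2 = D - X * D' = 1 - X^2\<close>. Hence both sides times \<open>D^2\<close> equal
  \<open>X^2 * (1 - X^2)\<close>, and \<open>D^2\<close> cancels because \<open>D\<close> has
  constant term 1.\<close>

lemma balancing_fps_riccati:
  "(1 - fps_X ^ 2) * balancing_fps ^ 2 = fps_X ^ 2 * fps_deriv balancing_fps"
proof -
  define D :: "real fps" where "D = 1 - 6 * fps_X + fps_X ^ 2"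
  define F where "F = balancing_fps"
  have FD: "F * D = fps_X"
    unfolding F_def D_def by (rule balancing_fps_mult_denominator)
  have D': "fps_deriv D = 2 * fps_X - 6"
    unfolding D_def by (simp add: power2_eq_square numeral_fps_const)
  have "fps_deriv (F * D) = 1"
    by (simp add: FD)
  then have "F * (2 * fps_X - 6) + fps_deriv F * D = 1"
    by (simp add: D')
  then have "(F * (2 * fps_X - 6) + fps_deriv F * D) * D = D"
    by simp
  then have "fps_deriv F * D ^ 2 = D - (F * D) * (2 * fps_X - 6)"
    by (simp add: algebra_simps power2_eq_square)
  also have "\<dots> = 1 - fps_X ^ 2"
    unfolding FD by (simp add: D_def algebra_simps power2_eq_square)
  finally have F': "fps_deriv F * D ^ 2 = 1 - fps_X ^ 2" .
  have "((1 - fps_X ^ 2) * F ^ 2) * D ^ 2 = (1 - fps_X ^ 2) * (F * D) ^ 2"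
    by (simp add: power_mult_distrib mult_ac)
  also have "\<dots> = (fps_X ^ 2 * fps_deriv F) * D ^ 2"
    unfolding FD by (simp add: F'[symmetric] mult_ac)
  finally have "((1 - fps_X ^ 2) * F ^ 2) * D ^ 2 = (fps_X ^ 2 * fps_deriv F) * D ^ 2" .
  moreover have "D $ 0 = 1"
    by (simp add: D_def)
  then have "D ^ 2 \<noteq> 0"
    by auto
  ultimately show ?thesis
    by (simp add: F_def)
qed

section \<open>Recurrence in \<open>s\<close> for the left-hand side\<close>

text \<open>The parameter \<open>s\<close> stands for \<open>r - 2\<close>.\<close>

definition balancing_power_fps :: "nat \<Rightarrow> real fps" where
  "balancing_power_fps s = (1 - fps_X ^ 2) ^ (2 * s + 1) * balancing_fps ^ (s + 2)"

lemma balancing_power_fps_0: "balancing_power_fps 0 = fps_X ^ 2 * fps_deriv balancing_fps"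
  using balancing_fps_riccati by (simp add: balancing_power_fps_def power2_eq_square)

text \<open>The term with \<open>2 * (2 * s + 1)\<close> cancels what comes from differentiating the
  power of \<open>1 - X^2\<close>. In the rest, the Riccati equation trades \<open>X^2 * F'\<close>
  for \<open>(1 - X^2) * F^2\<close>, which raises both exponents to those of
  \<open>Suc s\<close>.\<close>

lemma balancing_power_fps_Suc:
  "of_nat (s + 2) * balancing_power_fps (Suc s) =
    fps_X ^ 2 * ((1 - fps_X ^ 2) * fps_deriv (balancing_power_fps s)
      + of_nat (2 * (2 * s + 1)) * fps_X * balancing_power_fps s)"
proof -
  define E :: "real fps" where "E = 1 - fps_X ^ 2"
  define F where "F = balancing_fps"
  define P where "P = E ^ (2 * s)"
  define Q where "Q = F ^ (s + 1)"
  have E': "fps_deriv E = - (2 * fps_X)"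
    unfolding E_def by (simp add: power2_eq_square)
  have riccati: "fps_X ^ 2 * fps_deriv F = E * F ^ 2"
    using balancing_fps_riccati by (simp add: E_def F_def)
  have G: "balancing_power_fps s = E * P * (F * Q)"
    by (simp add: balancing_power_fps_def E_def F_def P_def Q_def)
  have G': "fps_deriv (balancing_power_fps s) =
      of_nat (2 * s + 1) * (- (2 * fps_X)) * P * (F * Q) + E * P * (of_nat (s + 2) * fps_deriv F * Q)"
    unfolding balancing_power_fps_def E_def[symmetric] F_def[symmetric] fps_deriv_mult fps_deriv_power' E'
    by (simp add: P_def Q_def)
  have "fps_X ^ 2 * (E * fps_deriv (balancing_power_fps s)
      + of_nat (2 * (2 * s + 1)) * fps_X * balancing_power_fps s) =
      of_nat (s + 2) * (E ^ 2 * P * Q * (fps_X ^ 2 * fps_deriv F))"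
    unfolding G' unfolding G by (simp add: algebra_simps power2_eq_square)
  also have "\<dots> = of_nat (s + 2) * balancing_power_fps (Suc s)"
    unfolding riccati balancing_power_fps_def E_def[symmetric] F_def[symmetric]
    by (simp add: P_def Q_def power2_eq_square mult_ac)
  finally show ?thesis
    by (simp add: E_def)
qed

lemma balancing_power_fps_nth_Suc:
  assumes "n \<ge> 3"
  shows "real (s + 2) * balancing_power_fps (Suc s) $ n =
    (real n - 1) * balancing_power_fps s $ (n - 1)
    - (real n - 4 * real s - 5) * balancing_power_fps s $ (n - 3)"
proof -
  let ?G = "balancing_power_fps s"
  obtain m where n: "n = m + 3"
    using assms by (metis add.commute le_Suc_ex)
  have "fps_const (real (s + 2)) * balancing_power_fps (Suc s) =
      fps_X ^ 2 * fps_deriv ?G - fps_X ^ 4 * fps_deriv ?G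
      + fps_const (real (2 * (2 * s + 1))) * (fps_X ^ 3 * ?G)"
    using balancing_power_fps_Suc[of s]
    by (simp add: fps_of_nat[symmetric] algebra_simps eval_nat_numeral)
  then have "(fps_const (real (s + 2)) * balancing_power_fps (Suc s)) $ n =
      (fps_X ^ 2 * fps_deriv ?G - fps_X ^ 4 * fps_deriv ?G
      + fps_const (real (2 * (2 * s + 1))) * (fps_X ^ 3 * ?G)) $ n"
    by simp
  then have "real (s + 2) * balancing_power_fps (Suc s) $ n =
      real (m + 2) * ?G $ (m + 2) - real m * ?G $ m + real (2 * (2 * s + 1)) * ?G $ m"
    \<comment> \<open>For \<open>m = 0\<close> the series \<open>X^4 * G'\<close> starts beyond
      \<open>n = 3\<close>; this agrees with the factor \<open>real m\<close>.\<close>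
    by (cases m) (simp_all add: n fps_X_power_mult_nth)
  then show ?thesis
    by (simp add: n algebra_simps numeral_eq_Suc)
qed

section \<open>Recurrence in \<open>s\<close> for the right-hand side\<close>

text \<open>The guards make a binomial coefficient with lower index \<open>-1\<close> vanish.\<close>

lemma gbinomial_product_recurrence:
  fixes x :: "'a::field_char_0"
  shows "of_nat (a + b) * ((x + 1) gchoose a) * ((x - 2 * of_nat a - of_nat b) gchoose b) =
    (if a = 0 then 0 else
      (x + 2 * of_nat b + 1) * (x gchoose (a - 1)) * ((x - 2 * of_nat a - of_nat b + 1) gchoose b))
    + (if b = 0 then 0 else
      (x - 2 * of_nat b - 4 * of_nat a + 1) * (x gchoose a)
        * ((x - 2 * of_nat a - of_nat b) gchoose (b - 1)))"
proof -
  \<comment> \<open>These absorption identities express all six binomials of the main case through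
    \<open>x gchoose c\<close> and \<open>y gchoose d\<close>.\<close>
  have up: "of_nat (Suc k) * ((y + 1) gchoose Suc k) = (y + 1) * (y gchoose k)"
    and same: "of_nat (Suc k) * (y gchoose Suc k) = (y - of_nat k) * (y gchoose k)" for y :: 'a and k
    using gbinomial_absorption[of k "y + 1"] gbinomial_mult_1[of y k] by (simp_all add: algebra_simps)
  show ?thesis
  proof (cases a)
    case 0
    then show ?thesis
      by (cases b) (use same[of "b - 1" "x - of_nat b"] in \<open>simp_all add: algebra_simps\<close>)
  next
    case (Suc c)
    show ?thesis
    proof (cases b)
      case 0
      then show ?thesis
        using Suc up[of c x] by (simp add: algebra_simps)
    next
      case (Suc d)
      define y where "y = x - 2 * of_nat a - of_nat b"
      define A B :: 'a where "A = of_nat (Suc c)" and "B = of_nat (Suc d)"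
      define P Q where "P = x gchoose c" and "Q = y gchoose d"
      have ne: "A \<noteq> 0" "B \<noteq> 0"
        unfolding A_def B_def by (simp_all only: of_nat_eq_0_iff)
      have ab: "of_nat a = A" "of_nat b = B"
        by (simp_all only: A_def B_def \<open>a = Suc c\<close> \<open>b = Suc d\<close>)
      have 1: "((x + 1) gchoose a) = (x + 1) * P / A" "((y + 1) gchoose b) = (y + 1) * Q / B"
        using up[of c x] up[of d y] ne
        by (simp_all add: A_def B_def P_def Q_def \<open>a = Suc c\<close> \<open>b = Suc d\<close> field_simps del: of_nat_Suc)
      have 2: "(x gchoose a) = (x - A + 1) * P / A" "(y gchoose b) = (y - B + 1) * Q / B"
        using same[of c x] same[of d y] ne
        by (simp_all add: A_def B_def P_def Q_def \<open>a = Suc c\<close> \<open>b = Suc d\<close> nonzero_eq_divide_eq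
            mult.commute del: of_nat_Suc) (simp_all add: algebra_simps)
      have 3: "x gchoose (a - 1) = P" "y gchoose (b - 1) = Q"
        by (simp_all add: P_def Q_def \<open>a = Suc c\<close> \<open>b = Suc d\<close>)
      have y: "y = x - 2 * A - B"
        by (simp add: y_def ab)
      \<comment> \<open>The whole claim, once the common factor \<open>P * Q / (A * B)\<close> is
        removed.\<close>
      have "(A + B) * (x + 1) * (y - B + 1) =
          (x + 2 * B + 1) * (y + 1) * A + (x - 2 * B - 4 * A + 1) * (x - A + 1) * B"
        unfolding y by (simp add: algebra_simps)
      \<comment> \<open>Stated for arbitrary factors, so that the polynomial identity enters as a
        single equation and is not expanded while clearing denominators.\<close>
      moreover have "s * ((t * P) / A) * ((u * Q) / B) = v * P * ((w * Q) / B) + p * ((q * P) / A) * Q"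
        if "s * t * u = v * w * A + p * q * B" for s t u v w p q :: 'a
      proof -
        have "s * ((t * P) / A) * ((u * Q) / B) = (s * t * u) * (P * Q) / (A * B)"
          by simp
        also have "\<dots> = v * P * ((w * Q) / B) + p * ((q * P) / A) * Q"
          unfolding that using ne by (simp add: field_simps)
        finally show ?thesis .
      qed
      ultimately have "(A + B) * ((x + 1) * P / A) * ((y - B + 1) * Q / B) =
          (x + 2 * B + 1) * P * ((y + 1) * Q / B) + (x - 2 * B - 4 * A + 1) * ((x - A + 1) * P / A) * Q"
        by blast
      then show ?thesis
        unfolding y_def[symmetric] unfolding 1 2 3 of_nat_add ab
        by (simp add: \<open>a = Suc c\<close> \<open>b = Suc d\<close>)
    qed
  qed
qed

text \<open>The summand for \<open>k = j + 1\<close> and \<open>r = s + 2\<close>, without the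
  balancing number and the denominator \<open>r - 1\<close>. A real \<open>x\<close> replaces
  \<open>n\<close>, so shifts of the argument involve no truncated subtraction.\<close>

definition balancing_coeff :: "nat \<Rightarrow> real \<Rightarrow> nat \<Rightarrow> real" where
  "balancing_coeff s x j = (-1) ^ j * (x - 2 * real j - real s - 1)
    * ((x - 2 * real j - 1) gchoose (s - j)) * ((x - real j - 2 * real s - 2) gchoose j)"

text \<open>This mirrors \<open>balancing_power_fps_nth_Suc\<close> term by term. The linear factor
  is the same in all three coefficients, and the sign change from \<open>j\<close> to
  \<open>j - 1\<close> turns the difference into the sum of
  \<open>gbinomial_product_recurrence\<close>, taken at \<open>y\<close>,
  \<open>a = s + 1 - j\<close> and \<open>b = j\<close>.\<close>

lemma balancing_coeff_Suc:
  assumes "j \<le> Suc s"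
  shows "real (s + 1) * balancing_coeff (Suc s) x j =
    (if j \<le> s then (x - 1) * balancing_coeff s (x - 1) j else 0)
    - (if j = 0 then 0 else (x - 4 * real s - 5) * balancing_coeff s (x - 3) (j - 1))"
proof -
  define y where "y = x - 2 * real j - 2"
  define a where "a = Suc s - j"
  define c where "c = (-1) ^ j * (x - 2 * real j - real s - 2)"
  have s: "real s = real a + real j - 1" and sj: "s + 1 = a + j"
    using assms by (auto simp: a_def)
  have x: "x = y + 2 * real j + 2"
    by (simp add: y_def)
  have lhs: "real (s + 1) * balancing_coeff (Suc s) x j =
      c * (real (a + j) * ((y + 1) gchoose a) * ((y - 2 * real a - real j) gchoose j))"
    unfolding balancing_coeff_def c_def a_def[symmetric] sj
    by (simp add: s x algebra_simps)
  have one: "(x - 1) * balancing_coeff s (x - 1) j =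
      c * ((y + 2 * real j + 1) * (y gchoose (a - 1)) * ((y - 2 * real a - real j + 1) gchoose j))"
    if "j \<le> s"
  proof -
    have "s - j = a - 1"
      using that by (simp add: a_def)
    then show ?thesis
      unfolding balancing_coeff_def c_def by (simp add: s x algebra_simps)
  qed
  have two: "(x - 4 * real s - 5) * balancing_coeff s (x - 3) (j - 1) =
      - c * ((y - 2 * real j - 4 * real a + 1) * (y gchoose a)
        * ((y - 2 * real a - real j) gchoose (j - 1)))" if "j \<noteq> 0"
  proof -
    obtain i where j: "j = Suc i"
      using \<open>j \<noteq> 0\<close> not0_implies_Suc by blast
    then have "s - (j - 1) = a"
      by (simp add: a_def)
    then show ?thesis
      unfolding balancing_coeff_def c_def by (simp add: s x j algebra_simps)
  qed
  have "a = 0 \<longleftrightarrow> \<not> j \<le> s"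
    using assms by (auto simp: a_def)
  then show ?thesis
    unfolding lhs gbinomial_product_recurrence using one two by (cases "j = 0") (simp_all add: distrib_left)
qed

text \<open>Induction on \<open>s\<close> using both recurrences. The step calls the hypothesis at
  \<open>n - 1\<close> and \<open>n - 3\<close>, so the bound on \<open>n\<close> grows by
  3.\<close>

lemma balancing_power_fps_nth:
  assumes "n \<ge> 3 * s + 1"
  shows "real (s + 1) * balancing_power_fps s $ n =
    (\<Sum>j\<le>s. balancing_coeff s (real n) j * real_of_int (balancing (n - 2 * j - s - 1)))"
  using assms
proof (induction s arbitrary: n)
  case 0
  then show ?case
    by (cases n rule: balancing.cases)
       (simp_all add: balancing_power_fps_0 balancing_coeff_def fps_X_power_mult_nth)
next
  case (Suc s)
  let ?B = "\<lambda>n s j. real_of_int (balancing (n - 2 * j - s - 1))"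
  let ?x = "real n"
  let ?G = "balancing_power_fps s"
  have n: "n \<ge> 3" "n - 1 \<ge> 3 * s + 1" "n - 3 \<ge> 3 * s + 1"
    using Suc.prems by auto
  then have x: "real (n - 1) = ?x - 1" "real (n - 3) = ?x - 3"
    by (simp_all add: of_nat_diff)
  \<comment> \<open>Term \<open>j\<close> at \<open>n - 1\<close> and term \<open>j\<close> at
    \<open>n - 3\<close> carry the balancing numbers of terms \<open>j\<close> and
    \<open>j + 1\<close> of the new sum.\<close>
  have idx: "n - 1 - 2 * j - s - 1 = n - 2 * j - Suc s - 1"
    "n - 3 - 2 * j - s - 1 = n - 2 * Suc j - Suc s - 1" for j
    by simp_all
  have "real (s + 1) * (real (s + 2) * balancing_power_fps (Suc s) $ n) =
      (?x - 1) * (real (s + 1) * ?G $ (n - 1)) - (?x - 4 * real s - 5) * (real (s + 1) * ?G $ (n - 3))"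
    unfolding balancing_power_fps_nth_Suc[OF n(1)] by (simp add: right_diff_distrib mult_ac)
  also have "\<dots> = (\<Sum>j\<le>s. (?x - 1) * balancing_coeff s (?x - 1) j * ?B n (Suc s) j)
      - (\<Sum>j\<le>s. (?x - 4 * real s - 5) * balancing_coeff s (?x - 3) j * ?B n (Suc s) (Suc j))"
    unfolding Suc.IH[OF n(2)] Suc.IH[OF n(3)] x idx
    by (simp only: sum_distrib_left mult.assoc)
  \<comment> \<open>Both sums are padded by a zero term to the range up to \<open>Suc s\<close>, the
    second after an index shift, so that they combine termwise.\<close>
  also have "(\<Sum>j\<le>s. (?x - 1) * balancing_coeff s (?x - 1) j * ?B n (Suc s) j) =
      (\<Sum>j\<le>Suc s. (if j \<le> s then (?x - 1) * balancing_coeff s (?x - 1) j else 0) * ?B n (Suc s) j)"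
    by simp
  also have "(\<Sum>j\<le>s. (?x - 4 * real s - 5) * balancing_coeff s (?x - 3) j * ?B n (Suc s) (Suc j)) =
      (\<Sum>j\<le>Suc s. (if j = 0 then 0 else (?x - 4 * real s - 5) * balancing_coeff s (?x - 3) (j - 1))
        * ?B n (Suc s) j)"
    by (subst sum.atMost_Suc_shift) simp
  also have "(\<Sum>j\<le>Suc s. (if j \<le> s then (?x - 1) * balancing_coeff s (?x - 1) j else 0) * ?B n (Suc s) j)
      - (\<Sum>j\<le>Suc s. (if j = 0 then 0 else (?x - 4 * real s - 5) * balancing_coeff s (?x - 3) (j - 1))
        * ?B n (Suc s) j) =
      (\<Sum>j\<le>Suc s. real (s + 1) * balancing_coeff (Suc s) ?x j * ?B n (Suc s) j)"
    unfolding sum_subtractf[symmetric]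
    by (rule sum.cong) (use balancing_coeff_Suc in \<open>auto simp: left_diff_distrib\<close>)
  also have "\<dots> = real (s + 1) * (\<Sum>j\<le>Suc s. balancing_coeff (Suc s) ?x j * ?B n (Suc s) j)"
    unfolding sum_distrib_left by (simp only: mult.assoc)
  finally show ?case
    by (simp del: sum.atMost_Suc)
qed

section \<open>From coefficients to the stated sums\<close>

lemma sum_positive_tuples_balancing:
  assumes "r > 0"
  shows "(\<Sum>js\<in>positive_tuples r (int m). \<Prod>i<r. real_of_int (balancing (js ! i))) =
    (balancing_fps ^ r) $ m"
proof -
  obtain q where r: "r = Suc q"
    using assms gr0_implies_Suc by blast
  have "(balancing_fps ^ r) $ m =
      (\<Sum>js\<in>natpermute m r. \<Prod>i<r. real_of_int (balancing (js ! i)))"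
    unfolding r fps_power_nth_Suc
    by (simp add: atLeast0AtMost lessThan_Suc_atMost)
  \<comment> \<open>Tuples with a zero entry contribute nothing because
    \<open>balancing 0 = 0\<close>.\<close>
  also have "\<dots> = (\<Sum>js\<in>positive_tuples r (int m). \<Prod>i<r. real_of_int (balancing (js ! i)))"
  proof (rule sum.mono_neutral_right)
    show "finite (natpermute m r)"
      by (rule natpermute_finite)
    show "positive_tuples r (int m) \<subseteq> natpermute m r"
      by (auto simp: positive_tuples_def natpermute_def)
    show "\<forall>js\<in>natpermute m r - positive_tuples r (int m).
        (\<Prod>i<r. real_of_int (balancing (js ! i))) = 0"
    proof
      fix js
      assume js: "js \<in> natpermute m r - positive_tuples r (int m)"
      then have "0 \<in> set js" "length js = r"
        by (auto simp: positive_tuples_def natpermute_def not_le)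
      then obtain i where "i < r" "js ! i = 0"
        by (auto simp: in_set_conv_nth)
      then show "(\<Prod>i<r. real_of_int (balancing (js ! i))) = 0"
        by (intro prod_zero) (auto intro!: bexI[of _ i])
    qed
  qed
  finally show ?thesis ..
qed

text \<open>The binomial theorem in \<open>-X^2\<close>. The guard \<open>n < 2 * l\<close> matches
  the empty set of tuples for a negative target sum.\<close>

lemma one_minus_X_square_power_mult_nth:
  fixes f :: "'a::comm_ring_1 fps"
  shows "((1 - fps_X ^ 2) ^ p * f) $ n =
    (\<Sum>l = 0..p. (-1) ^ l * of_nat (p choose l) * (if n < 2 * l then 0 else f $ (n - 2 * l)))"
proof -
  have "(1 - fps_X ^ 2 :: 'a fps) ^ p = (- (fps_X ^ 2) + 1) ^ p"
    by simp
  also have "\<dots> = (\<Sum>l = 0..p. of_nat (p choose l) * (- (fps_X ^ 2)) ^ l)"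
    unfolding binomial_ring by (simp add: atLeast0AtMost)
  also have "\<dots> = (\<Sum>l = 0..p. fps_const ((-1) ^ l * of_nat (p choose l)) * fps_X ^ (2 * l))"
  proof (rule sum.cong)
    fix l
    have "(- (fps_X ^ 2)) ^ l = (-1) ^ l * (fps_X ^ (2 * l) :: 'a fps)"
      by (subst power_minus) (simp add: power_mult)
    moreover have "fps_const ((-1) ^ l) = ((-1) ^ l :: 'a fps)"
      by (cases "even l") (simp_all add: fps_eq_iff)
    ultimately show "of_nat (p choose l) * (- (fps_X ^ 2)) ^ l =
        fps_const ((-1) ^ l * of_nat (p choose l)) * (fps_X ^ (2 * l) :: 'a fps)"
      by (simp add: fps_of_nat mult_ac flip: fps_const_mult)
  qed simp
  finally show ?thesis
    by (simp add: sum_distrib_right fps_sum_nth mult.assoc fps_X_power_mult_nth)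
qed

theorem theorem3:
  fixes r n :: nat
  assumes "r \<ge> 2" and "n \<ge> 3 * r - 5"
  shows "(\<Sum>l = 0..2 * r - 3. (-1) ^ l * real ((2 * r - 3) choose l) *
            (\<Sum>js\<in>positive_tuples r (int n - 2 * int l). \<Prod>i<r. real_of_int (balancing (js ! i))))
       = (\<Sum>k = 1..r - 1. (-1) ^ (k - 1) * ((real n - 2 * real k - real r + 3) / (real r - 1)) *
            real ((n + 1 - 2 * k) choose (r - k - 1)) *
            real ((n + 3 - k - 2 * r) choose (k - 1)) *
            real_of_int (balancing (n + 3 - 2 * k - r)))"
proof -
  obtain s where r: "r = s + 2"
    using assms(1) by (metis add.commute le_Suc_ex)
  have n: "n \<ge> 3 * s + 1"
    using assms(2) r by simp
  have "(\<Sum>l = 0..2 * r - 3. (-1) ^ l * real ((2 * r - 3) choose l) *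
      (\<Sum>js\<in>positive_tuples r (int n - 2 * int l). \<Prod>i<r. real_of_int (balancing (js ! i)))) =
      (\<Sum>l = 0..2 * r - 3. (-1) ^ l * real ((2 * r - 3) choose l) *
        (if n < 2 * l then 0 else (balancing_fps ^ r) $ (n - 2 * l)))"
  proof (intro sum.cong refl arg_cong2[of _ _ _ _ "(*)"])
    fix l
    show "(\<Sum>js\<in>positive_tuples r (int n - 2 * int l). \<Prod>i<r. real_of_int (balancing (js ! i))) =
        (if n < 2 * l then 0 else (balancing_fps ^ r) $ (n - 2 * l))"
    proof (cases "n < 2 * l")
      case True
      then have "positive_tuples r (int n - 2 * int l) = {}"
        by (auto simp: positive_tuples_def)
      then show ?thesis
        using True by simp
    next
      case False
      then have "int n - 2 * int l = int (n - 2 * l)"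
        by simp
      then show ?thesis
        using False sum_positive_tuples_balancing[of r "n - 2 * l"] r by simp
    qed
  qed
  also have "\<dots> = balancing_power_fps s $ n"
    unfolding one_minus_X_square_power_mult_nth[symmetric] balancing_power_fps_def by (simp add: r)
  also have "\<dots> = (\<Sum>j\<le>s. balancing_coeff s (real n) j * real_of_int (balancing (n - 2 * j - s - 1)))
      / real (s + 1)"
    using balancing_power_fps_nth[OF n] by (simp add: field_simps)
  also have "\<dots> = (\<Sum>j\<le>s. (-1) ^ j * ((real n - 2 * real j - real s - 1) / (real s + 1)) *
      real ((n - 2 * j - 1) choose (s - j)) * real ((n - j - 2 * s - 2) choose j) *
      real_of_int (balancing (n - 2 * j - s - 1)))"
    unfolding sum_divide_distrib
  proof (rule sum.cong)
    fix j
    assume "j \<in> {..s}"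
    then have j: "j \<le> s"
      by simp
    show "balancing_coeff s (real n) j * real_of_int (balancing (n - 2 * j - s - 1)) / real (s + 1) =
        (-1) ^ j * ((real n - 2 * real j - real s - 1) / (real s + 1)) *
        real ((n - 2 * j - 1) choose (s - j)) * real ((n - j - 2 * s - 2) choose j) *
        real_of_int (balancing (n - 2 * j - s - 1))"
    proof (cases "n = 2 * j + s + 1")
      \<comment> \<open>the only case in which \<open>n - j - 2 * s - 2\<close> may be truncated; there the balancing number vanishes\<close>
      case True
      then show ?thesis
        by simp
    next
      case False
      \<comment> \<open>For \<open>j < s\<close> the second bound follows from
        \<open>n >= 3 * s + 1\<close>; for \<open>j = s\<close> the excluded value is exactly
        \<open>3 * s + 1\<close>, which supplies the missing 1.\<close>
      then have "n - 2 * j \<ge> 1" "n \<ge> j + 2 * s + 2"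
        using n j by auto
      then have "real (n - 2 * j - 1) = real n - 2 * real j - 1"
        "real (n - j - 2 * s - 2) = real n - real j - 2 * real s - 2"
        by (simp_all add: of_nat_diff)
      then show ?thesis
        by (simp add: balancing_coeff_def binomial_gbinomial)
    qed
  qed simp
  also have "\<dots> = (\<Sum>k = 1..r - 1. (-1) ^ (k - 1) * ((real n - 2 * real k - real r + 3) / (real r - 1)) *
            real ((n + 1 - 2 * k) choose (r - k - 1)) *
            real ((n + 3 - k - 2 * r) choose (k - 1)) *
            real_of_int (balancing (n + 3 - 2 * k - r)))"
  proof (rule sum.reindex_bij_witness[of _ "\<lambda>k. k - 1" Suc])
    fix j
    \<comment> \<open>The equalities between natural numbers hold for truncated subtraction as
      well.\<close>
    have "real n - 2 * real (Suc j) - real r + 3 = real n - 2 * real j - real s - 1"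
      "real r - 1 = real s + 1" "n + 1 - 2 * Suc j = n - 2 * j - 1" "r - Suc j - 1 = s - j"
      "n + 3 - Suc j - 2 * r = n - j - 2 * s - 2" "n + 3 - 2 * Suc j - r = n - 2 * j - s - 1"
      by (simp_all add: r)
    then show "(-1) ^ (Suc j - 1) * ((real n - 2 * real (Suc j) - real r + 3) / (real r - 1)) *
        real ((n + 1 - 2 * Suc j) choose (r - Suc j - 1)) *
        real ((n + 3 - Suc j - 2 * r) choose (Suc j - 1)) *
        real_of_int (balancing (n + 3 - 2 * Suc j - r)) =
        (-1) ^ j * ((real n - 2 * real j - real s - 1) / (real s + 1)) *
        real ((n - 2 * j - 1) choose (s - j)) * real ((n - j - 2 * s - 2) choose j) *
        real_of_int (balancing (n - 2 * j - s - 1))"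
      by (simp only: diff_Suc_1)
  qed (auto simp: r)
  finally show ?thesis .
qed

end
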